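(* Let $1<\alpha\leq 2$ and $0<\beta\leq 1$ be such that $\alpha-\beta-1\geq 0$. Then the Mittag--Leffler function $$E_{\alpha-\beta,\alpha}(x)=\sum_{k=0}^\infty\frac{x^k}{\Gamma(k(\alpha-\beta)+\alpha)}$$ has no real zeros for $x\in(-\nu,0)$, where $$\nu=\frac{\Gamma(\alpha-\beta)}{\max\left\{\int_0^1\Delta(s)\,ds,\ B(\alpha-\beta,\alpha)\right\}},$$ and where, for $s\in[0,1]$, $\Delta(s)=\max\left\{s^{\alpha-\beta-1}(1-s)^{\alpha-1},\ (1-s)^{\alpha-\beta-1}-(1-s)^{\alpha-1}\right\}$ if $\alpha-\beta-1>0$, and $\Delta(s)=(1-s)^{\alpha-\beta-1}-(1-s)^{\alpha-1}$ if $\alpha-\beta-1=0$.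
   Context: $\Gamma$ is the Gamma function and $B(x,y)=\int_0^1 s^{x-1}(1-s)^{y-1}\,ds$ is the Beta function. Powers with exponent $0$ are equal to $1$. *)

theory Defs
  imports "HOL-Analysis.Analysis"
begin

definition mittag_leffler :: "real \<Rightarrow> real \<Rightarrow> real \<Rightarrow> real" where
  "mittag_leffler a b x = (\<Sum>k. x ^ k / Gamma (real k * a + b))"

text \<open>Real powers of a nonnegative base with the convention that exponent 0 gives 1 also at base 0;
  the library's \<open>powr\<close> has \<open>0 powr 0 = 0\<close>.\<close>

definition rpow :: "real \<Rightarrow> real \<Rightarrow> real" where
  "rpow x a = (if a = 0 then 1 else x powr a)"

text \<open>Only used for \<open>\<alpha> - \<beta> - 1 \<ge> 0\<close> and \<open>0 \<le> s \<le> 1\<close>, so the last branch is the case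
  \<open>\<alpha> - \<beta> - 1 = 0\<close>.\<close>

definition Delta :: "real \<Rightarrow> real \<Rightarrow> real \<Rightarrow> real" where
  "Delta \<alpha> \<beta> s =
    (if \<alpha> - \<beta> - 1 > 0
     then max (rpow s (\<alpha> - \<beta> - 1) * rpow (1 - s) (\<alpha> - 1))
              (rpow (1 - s) (\<alpha> - \<beta> - 1) - rpow (1 - s) (\<alpha> - 1))
     else rpow (1 - s) (\<alpha> - \<beta> - 1) - rpow (1 - s) (\<alpha> - 1))"

text \<open>The library defines \<open>Beta\<close> through \<open>Gamma\<close>; it agrees with Euler's integral.\<close>

lemma Beta_eq_integral:
  fixes x y :: real
  assumes "x > 0" "y > 0"
  shows "Beta x y = integral {0..1} (\<lambda>s. rpow s (x - 1) * rpow (1 - s) (y - 1))"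
proof -
  have "((\<lambda>s. s powr (x - 1) * (1 - s) powr (y - 1)) has_integral Beta x y) {0..1}"
    by (rule has_integral_Beta_real) (use assms in auto)
  then have "((\<lambda>s. rpow s (x - 1) * rpow (1 - s) (y - 1)) has_integral Beta x y) {0..1}"
    by (rule has_integral_spike_finite[where S = "{0, 1}", rotated 2]) (auto simp: rpow_def)
  then show ?thesis
    by (simp add: integral_unique)
qed

definition nu :: "real \<Rightarrow> real \<Rightarrow> real" where
  "nu \<alpha> \<beta> = Gamma (\<alpha> - \<beta>) / max (integral {0..1} (Delta \<alpha> \<beta>)) (Beta (\<alpha> - \<beta>) \<alpha>)"

end

theory Submission
  imports Defs
begin

text \<open>
  Put \<open>\<gamma> = \<alpha> - \<beta>\<close>. For \<open>x < 0\<close> the Mittag-Leffler series alternates, with terms of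
  absolute value \<open>t k = (-x)^k / \<Gamma>(k\<gamma> + \<alpha>)\<close>. Consecutive terms have the ratio
  \<open>t (k+1) / t k = (-x) \<Gamma>(k\<gamma> + \<alpha>) / \<Gamma>(k\<gamma> + \<alpha> + \<gamma>) = (-x) B(\<gamma>, k\<gamma> + \<alpha>) / \<Gamma>(\<gamma>)\<close>,
  and Euler's integral shows that \<open>B(\<gamma>, y)\<close> decreases in \<open>y\<close>. So all these ratios are at
  most the first one, \<open>(-x) B(\<gamma>, \<alpha>) / \<Gamma>(\<gamma>)\<close>. The maximum in the denominator of \<open>\<nu>\<close> is at least
  \<open>B(\<gamma>, \<alpha>)\<close>, so for \<open>-\<nu> < x < 0\<close> the first ratio is less than 1: the terms decrease to 0 at
  least geometrically, and Leibniz' estimate bounds the sum below by \<open>t 0 - t 1 > 0\<close>.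
\<close>

text \<open>Euler's integrand \<open>s powr (a - 1) * (1 - s) powr (y - 1)\<close> is pointwise decreasing in \<open>y\<close>,
  since \<open>1 - s\<close> lies in \<open>[0, 1]\<close>.\<close>

lemma Beta_antimono_right:
  fixes a y z :: real
  assumes "0 < a" "0 < y" "y \<le> z"
  shows "Beta a z \<le> Beta a y"
proof (rule has_integral_le)
  show "((\<lambda>s. s powr (a - 1) * (1 - s) powr (z - 1)) has_integral Beta a z) {0..1}"
    by (rule has_integral_Beta_real) (use assms in auto)
  show "((\<lambda>s. s powr (a - 1) * (1 - s) powr (y - 1)) has_integral Beta a y) {0..1}"
    by (rule has_integral_Beta_real) (use assms in auto)
  show "s powr (a - 1) * (1 - s) powr (z - 1) \<le> s powr (a - 1) * (1 - s) powr (y - 1)"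
    if "s \<in> {0..1}" for s
    using that assms by (intro mult_left_mono powr_mono') auto
qed

lemma Gamma_quotient_antimono:
  fixes a y z :: real
  assumes "0 < a" "0 < y" "y \<le> z"
  shows "Gamma z / Gamma (z + a) \<le> Gamma y / Gamma (y + a)"
proof -
  have "Gamma w / Gamma (w + a) = Beta a w / Gamma a" for w
    using Gamma_real_pos[OF assms(1)] by (simp add: Beta_def add.commute)
  then show ?thesis
    using Beta_antimono_right[OF assms] Gamma_real_pos[OF assms(1)]
    by (simp add: divide_right_mono)
qed

text \<open>The bound on \<open>x\<close> says exactly that the second term of the series is smaller in absolute
  value than the first; antitonicity of the Gamma quotient passes this on to all later terms.\<close>

lemma mittag_leffler_pos:
  fixes a b x :: real
  assumes a: "0 < a" and b: "0 < b"
    and x: "- (Gamma (b + a) / Gamma b) < x" "x \<le> 0"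
  shows "mittag_leffler a b x > 0"
proof -
  define t where "t k = (- x) ^ k / Gamma (real k * a + b)" for k :: nat
  define q where "q = - x * (Gamma b / Gamma (b + a))"
  have arg_ge: "b \<le> real k * a + b" for k
    using a by simp
  have Gamma_pos: "Gamma (real k * a + b) > 0" for k
    by (rule Gamma_real_pos) (use arg_ge[of k] b in linarith)
  have t_nonneg: "0 \<le> t k" for k
    using Gamma_pos[of k] x by (simp add: t_def)
  have "Gamma (b + a) > 0" "Gamma b > 0"
    using a b by (auto intro: Gamma_real_pos)
  then have q: "0 \<le> q" "q < 1"
    using x by (auto simp: q_def field_simps mult_nonneg_nonpos2 mult_nonneg_nonpos)
  have t_ratio: "t (Suc k) \<le> q * t k" for k
  proof -
    let ?y = "real k * a + b"
    have "t (Suc k) = t k * (- x * (Gamma ?y / Gamma (?y + a)))"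
      using Gamma_pos[of k] by (simp add: t_def algebra_simps)
    also have "\<dots> \<le> t k * q"
      unfolding q_def
      by (intro mult_left_mono Gamma_quotient_antimono a b arg_ge t_nonneg) (use x in auto)
    finally show ?thesis
      by (simp add: mult.commute)
  qed
  have "summable t"
    by (rule summable_ratio_test[of q 0]) (use q t_ratio t_nonneg in auto)
  then have "t \<longlonglongrightarrow> 0"
    by (rule summable_LIMSEQ_zero)
  moreover have "t (Suc k) \<le> t k" for k
    using t_ratio[of k] mult_right_mono[of q 1 "t k"] q t_nonneg[of k] by simp
  ultimately have "(\<Sum>k<2 * 1. (-1) ^ k * t k) \<le> (\<Sum>k. (-1) ^ k * t k)"
    by (intro summable_Leibniz'(2) t_nonneg)
  moreover have "(-1) ^ k * t k = x ^ k / Gamma (real k * a + b)" for k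
    by (simp add: t_def flip: power_mult_distrib)
  then have "(\<Sum>k. (-1) ^ k * t k) = mittag_leffler a b x"
    unfolding mittag_leffler_def by presburger
  ultimately have "t 0 - t 1 \<le> mittag_leffler a b x"
    by (simp add: numeral_2_eq_2)
  moreover have "t 0 > 0"
    using Gamma_pos[of 0] by (simp add: t_def)
  then have "q * t 0 < 1 * t 0"
    by (intro mult_strict_right_mono q)
  then have "t 1 < t 0"
    using t_ratio[of 0] unfolding One_nat_def by linarith
  ultimately show ?thesis
    by simp
qed

text \<open>By \<open>B(\<alpha> - \<beta>, \<alpha>) = \<Gamma>(\<alpha> - \<beta>) \<Gamma>(\<alpha>) / \<Gamma>(2\<alpha> - \<beta>)\<close>, the right-hand side is the quotient
  \<open>\<Gamma>(\<alpha> - \<beta>) / B(\<alpha> - \<beta>, \<alpha>)\<close>.\<close>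

lemma nu_le_Gamma_quotient:
  assumes "0 < \<alpha>" "0 < \<alpha> - \<beta>"
  shows "nu \<alpha> \<beta> \<le> Gamma (\<alpha> + (\<alpha> - \<beta>)) / Gamma \<alpha>"
proof -
  let ?B = "Beta (\<alpha> - \<beta>) \<alpha>"
  have pos: "Gamma (\<alpha> - \<beta>) > 0" "Gamma \<alpha> > 0" "Gamma (\<alpha> + (\<alpha> - \<beta>)) > 0"
    by (rule Gamma_real_pos, use assms in linarith)+
  have B: "?B = Gamma (\<alpha> - \<beta>) * Gamma \<alpha> / Gamma (\<alpha> + (\<alpha> - \<beta>))"
    by (simp add: Beta_def add.commute)
  then have "?B > 0"
    using pos by simp
  then have "nu \<alpha> \<beta> \<le> Gamma (\<alpha> - \<beta>) / ?B"
    unfolding nu_def using pos by (intro divide_left_mono) auto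
  also have "\<dots> = Gamma (\<alpha> + (\<alpha> - \<beta>)) / Gamma \<alpha>"
    unfolding B using pos by simp
  finally show ?thesis .
qed

theorem theorem3p14:
  fixes \<alpha> \<beta> :: real
  assumes "1 < \<alpha>" and "\<alpha> \<le> 2"
    and "0 < \<beta>" and "\<beta> \<le> 1"
    and "\<alpha> - \<beta> - 1 \<ge> 0"
  shows "\<forall>x \<in> {- nu \<alpha> \<beta> <..< 0}. mittag_leffler (\<alpha> - \<beta>) \<alpha> x \<noteq> 0"
proof
  fix x assume x: "x \<in> {- nu \<alpha> \<beta> <..< 0}"
  have "nu \<alpha> \<beta> \<le> Gamma (\<alpha> + (\<alpha> - \<beta>)) / Gamma \<alpha>"
    by (rule nu_le_Gamma_quotient) (use assms in auto)
  then have "mittag_leffler (\<alpha> - \<beta>) \<alpha> x > 0"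
    by (intro mittag_leffler_pos) (use assms x in auto)
  then show "mittag_leffler (\<alpha> - \<beta>) \<alpha> x \<noteq> 0"
    by simp
qed

end
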